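(* Let $f$ satisfy the growth condition $|f(x)|\leq Kx^{m\operatorname{Re}\rho}e^{x/\beta}$ for all $x>T$, where $K,T,\beta$ are positive constants. Then $$\mathcal M_{\rho,m}[f(\alpha^2x)](u,v,\omega)=\alpha^{m\rho-1}\,\mathcal M_{\rho,m}[f(x)]\Big(\frac u\alpha,\alpha v,\alpha\omega\Big),\qquad \alpha>0,$$ where $\rho\in\mathbb C$, $\operatorname{Re}\rho>0$, $m\in\mathbb N$, $u,v\in\mathbb C$ and $\omega\in\mathbb R^+$.
   Context: $\mathbb N=\{1,2,\dots\}$ and $\mathbb R^+$ denotes the positive reals. The transform of a function $f$ on $(0,\infty)$ is $$\mathcal M_{\rho,m}[f(x)](u,v,\omega)=\int_0^\infty \frac{e^{-ux-v/x}}{(x^m+\omega^m)^\rho}f(\omega x)\,dx.$$ The letter $x$ inside the brackets is a dummy variable; $\mathcal M_{\rho,m}[f(\alpha^2x)]$ is the transform of the function $x\mapsto f(\alpha^2x)$. *)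

theory Defs
  imports "HOL-Analysis.Analysis"
begin

text \<open>
  The base \<open>x ^ m + \<omega> ^ m\<close> is a positive real for \<open>x, \<omega> > 0\<close>, so the
  complex power below is the unambiguous \<open>exp (\<rho> * ln (x ^ m + \<omega> ^ m))\<close>.
  Only the values of \<open>f\<close> on \<open>{0<..}\<close> matter when \<open>\<omega> > 0\<close>.
\<close>

definition M_integrand ::
    "complex \<Rightarrow> nat \<Rightarrow> (real \<Rightarrow> complex) \<Rightarrow> complex \<Rightarrow> complex \<Rightarrow> real \<Rightarrow> real \<Rightarrow> complex" where
  "M_integrand \<rho> m f u v \<omega> x =
     exp (- u * complex_of_real x - v / complex_of_real x)
       / complex_of_real (x ^ m + \<omega> ^ m) powr \<rho> * f (\<omega> * x)"

text \<open>
  The Henstock--Kurzweil integral over \<open>{0<..}\<close> covers both absolutely convergent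
  (Lebesgue) and conditionally convergent improper integrals; \<open>M_converges\<close> records
  existence, since \<open>integral\<close> is the default value 0 where it fails.
\<close>

definition M_converges ::
    "complex \<Rightarrow> nat \<Rightarrow> (real \<Rightarrow> complex) \<Rightarrow> complex \<Rightarrow> complex \<Rightarrow> real \<Rightarrow> bool" where
  "M_converges \<rho> m f u v \<omega> \<longleftrightarrow> M_integrand \<rho> m f u v \<omega> integrable_on {0<..}"

definition M_transform ::
    "complex \<Rightarrow> nat \<Rightarrow> (real \<Rightarrow> complex) \<Rightarrow> complex \<Rightarrow> complex \<Rightarrow> real \<Rightarrow> complex" where
  "M_transform \<rho> m f u v \<omega> = integral {0<..} (M_integrand \<rho> m f u v \<omega>)"

end

theory Submission
  imports Defs
begin

text \<open>
  The substitution \<open>y = \<alpha> x\<close> maps the integrand of the right-hand transform, up to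
  the constant factor \<open>\<alpha> powr (- m \<rho>)\<close>, to the integrand of the left-hand one. Scaling by a
  positive constant is a change of variables for the Henstock--Kurzweil integral over any set,
  so convergence, conditional or absolute, transfers both ways.
\<close>

text \<open>On an unbounded set the integral is a limit over boxes containing large balls. Scaling
  by \<open>c\<close> maps boxes to boxes and centred balls to centred balls, so the affine
  substitution on each box passes to that limit for arbitrary \<open>S\<close>.\<close>

lemma has_integral_scaleR_vimage:
  fixes f :: "'a::euclidean_space \<Rightarrow> 'b::banach"
  assumes f: "(f has_integral I) S" and c: "c > 0"
  shows "((\<lambda>x. f (c *\<^sub>R x)) has_integral (I /\<^sub>R c ^ DIM('a))) ((*\<^sub>R) c -` S)"
proof (subst has_integral', intro allI impI)
  fix e :: real
  assume "e > 0"
  \<comment> \<open>The Jacobian of the scaling; asking for accuracy \<open>e * d\<close> before the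
    substitution leaves \<open>e\<close> after division by \<open>d\<close>.\<close>
  define d where "d = c ^ DIM('a)"
  have d: "d > 0"
    using c by (simp add: d_def)
  with \<open>e > 0\<close> have "e * d > 0"
    by simp
  with f[unfolded has_integral'[of f I S]] obtain B where "B > 0"
    and B: "\<And>a b. ball 0 B \<subseteq> cbox a b \<Longrightarrow>
      \<exists>z. ((\<lambda>x. if x \<in> S then f x else 0) has_integral z) (cbox a b) \<and> norm (z - I) < e * d"
    by meson
  show "\<exists>B>0. \<forall>a b. ball 0 B \<subseteq> cbox a b \<longrightarrow>
    (\<exists>z. ((\<lambda>x. if x \<in> (*\<^sub>R) c -` S then f (c *\<^sub>R x) else 0) has_integral z) (cbox a b) \<and>
      norm (z - I /\<^sub>R c ^ DIM('a)) < e)"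
  \<comment> \<open>Scaling by \<open>c\<close> carries the ball of radius \<open>B / c\<close> onto
    the ball of radius \<open>B\<close>.\<close>
  proof (intro exI[of _ "B / c"] conjI allI impI)
    show "B / c > 0"
      using \<open>B > 0\<close> c by simp
    fix a b :: 'a
    assume ab: "ball 0 (B / c) \<subseteq> cbox a b"
    have "ball 0 B \<subseteq> cbox (c *\<^sub>R a) (c *\<^sub>R b)"
    proof
      fix x :: 'a
      assume "x \<in> ball 0 B"
      then have "x /\<^sub>R c \<in> ball 0 (B / c)"
        using c by (simp add: field_simps)
      with ab have "x /\<^sub>R c \<in> cbox a b"
        by blast
      then show "x \<in> cbox (c *\<^sub>R a) (c *\<^sub>R b)"
        using c by (simp add: mem_box field_simps)
    qed
    then obtain z
      where z: "((\<lambda>x. if x \<in> S then f x else 0) has_integral z) (cbox (c *\<^sub>R a) (c *\<^sub>R b))"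
        and zI: "norm (z - I) < e * d"
      using B by blast
    have "((\<lambda>x. if x \<in> (*\<^sub>R) c -` S then f (c *\<^sub>R x) else 0) has_integral (z /\<^sub>R d)) (cbox a b)"
      using has_integral_affinity'[OF z c, of 0] c by (simp add: d_def cong: if_cong)
    moreover have "norm (z /\<^sub>R d - I /\<^sub>R c ^ DIM('a)) < e"
    proof -
      have "norm (z /\<^sub>R d - I /\<^sub>R d) = norm (z - I) / d"
        using d by (simp add: divide_inverse mult.commute flip: scaleR_diff_right)
      also have "\<dots> < e"
        using zI d by (simp add: pos_divide_less_eq)
      finally show ?thesis
        by (simp add: d_def)
    qed
    ultimately show "\<exists>z. ((\<lambda>x. if x \<in> (*\<^sub>R) c -` S then f (c *\<^sub>R x) else 0) has_integral z)
        (cbox a b) \<and> norm (z - I /\<^sub>R c ^ DIM('a)) < e"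
      by blast
  qed
qed

text \<open>The half-line is its own preimage under every positive scaling; the forward implication
  is the scaling rule for the inverse factor \<open>1 / c\<close>.\<close>

lemma has_integral_stretch_Ioi_iff:
  fixes f :: "real \<Rightarrow> 'b::banach"
  assumes c: "c > 0"
  shows "((\<lambda>x. f (c * x)) has_integral I) {0<..} \<longleftrightarrow> (f has_integral (c *\<^sub>R I)) {0<..}"
proof -
  have vimage: "(*\<^sub>R) k -` {0<..} = {0::real<..}" if "k > 0" for k :: real
    using that by (auto simp: zero_less_mult_iff)
  show ?thesis
  proof
    assume "((\<lambda>x. f (c * x)) has_integral I) {0<..}"
    from has_integral_scaleR_vimage[OF this, of "1 / c"] c
    show "(f has_integral (c *\<^sub>R I)) {0<..}"
      by (simp add: vimage)
  next
    assume "(f has_integral (c *\<^sub>R I)) {0<..}"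
    from has_integral_scaleR_vimage[OF this c] c
    show "((\<lambda>x. f (c * x)) has_integral I) {0<..}"
      by (simp add: vimage)
  qed
qed

lemma M_integrand_dilate:
  assumes "\<alpha> > 0" "\<omega> > 0" "x > 0"
  shows "M_integrand \<rho> m (\<lambda>x. f (\<alpha>\<^sup>2 * x)) u v \<omega> x =
    complex_of_real \<alpha> powr (of_nat m * \<rho>) *
    M_integrand \<rho> m f (u / complex_of_real \<alpha>) (complex_of_real \<alpha> * v) (\<alpha> * \<omega>) (\<alpha> * x)"
proof -
  define s where "s = x ^ m + \<omega> ^ m"
  have s: "s > 0"
    using assms by (simp add: s_def add_pos_pos)
  have "(\<alpha> * x) ^ m + (\<alpha> * \<omega>) ^ m = \<alpha> ^ m * s"
    by (simp add: s_def power_mult_distrib distrib_left)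
  moreover have "complex_of_real (\<alpha> ^ m * s) powr \<rho> =
      complex_of_real \<alpha> powr (of_nat m * \<rho>) * complex_of_real s powr \<rho>"
  proof -
    \<comment> \<open>All arguments are positive reals, so \<open>Ln\<close> is the real logarithm
      and splits without any branch correction.\<close>
    have "Ln (complex_of_real (\<alpha> ^ m * s)) =
        of_nat m * Ln (complex_of_real \<alpha>) + Ln (complex_of_real s)"
      using assms s
      by (simp add: Ln_of_real ln_mult ln_realpow del: of_real_mult of_real_power) simp
    then show ?thesis
      using assms s by (simp add: powr_def exp_add[symmetric] algebra_simps)
  qed
  \<comment> \<open>The prefactor is cancelled against the same factor in the right-hand
    denominator, hence must be nonzero.\<close>
  moreover have "complex_of_real \<alpha> powr (of_nat m * \<rho>) \<noteq> 0"
    using assms by simp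
  moreover have "\<alpha> * \<omega> * (\<alpha> * x) = \<alpha>\<^sup>2 * (\<omega> * x)"
    by (simp add: power2_eq_square)
  moreover have "- (u / complex_of_real \<alpha>) * complex_of_real (\<alpha> * x)
        - complex_of_real \<alpha> * v / complex_of_real (\<alpha> * x) =
      - u * complex_of_real x - v / complex_of_real x"
    using assms by simp
  ultimately show ?thesis
    unfolding M_integrand_def s_def[symmetric]
    by (simp only: times_divide_eq_right times_divide_eq_left mult_divide_mult_cancel_left
        simp_thms)
qed

text \<open>The equivalence of convergence is stated alongside the identity because
  \<open>integral\<close> is 0 on divergent integrands, so the identity alone would not show that
  both sides exist together.\<close>

theorem theorem2p2:
  fixes f :: "real \<Rightarrow> complex" and K T \<beta> :: real
    and \<rho> u v :: complex and m :: nat and \<omega> \<alpha> :: real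
  assumes "K > 0" and "T > 0" and "\<beta> > 0"
    and growth: "\<And>x. x > T \<Longrightarrow> norm (f x) \<le> K * x powr (real m * Re \<rho>) * exp (x / \<beta>)"
    and "Re \<rho> > 0" and "m \<ge> 1" and "\<omega> > 0" and "\<alpha> > 0"
  shows "(M_converges \<rho> m (\<lambda>x. f (\<alpha>\<^sup>2 * x)) u v \<omega> \<longleftrightarrow>
            M_converges \<rho> m f (u / complex_of_real \<alpha>) (complex_of_real \<alpha> * v) (\<alpha> * \<omega>))
       \<and> M_transform \<rho> m (\<lambda>x. f (\<alpha>\<^sup>2 * x)) u v \<omega> =
            complex_of_real \<alpha> powr (of_nat m * \<rho> - 1) *
            M_transform \<rho> m f (u / complex_of_real \<alpha>) (complex_of_real \<alpha> * v) (\<alpha> * \<omega>)"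
proof -
  define F where "F = M_integrand \<rho> m (\<lambda>x. f (\<alpha>\<^sup>2 * x)) u v \<omega>"
  define G where
    "G = M_integrand \<rho> m f (u / complex_of_real \<alpha>) (complex_of_real \<alpha> * v) (\<alpha> * \<omega>)"
  define k where "k = complex_of_real \<alpha> powr (of_nat m * \<rho>)"
  have k: "k \<noteq> 0"
    using \<open>\<alpha> > 0\<close> by (simp add: k_def)
  \<comment> \<open>The exponent \<open>m * \<rho>\<close> comes from the integrand, the -1 from the
    Jacobian of \<open>y = \<alpha> x\<close>.\<close>
  have factor: "complex_of_real \<alpha> powr (of_nat m * \<rho> - 1) = k / complex_of_real \<alpha>"
    using \<open>\<alpha> > 0\<close> by (simp add: k_def powr_diff)
  have F_eq: "F x = k * G (\<alpha> * x)" if "x > 0" for x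
    using M_integrand_dilate[OF \<open>\<alpha> > 0\<close> \<open>\<omega> > 0\<close> that] by (simp add: F_def G_def k_def)
  have F_of_G: "(F has_integral (k / complex_of_real \<alpha> * J)) {0<..}"
    if "(G has_integral J) {0<..}" for J
  proof -
    have "((\<lambda>x. G (\<alpha> * x)) has_integral (J / complex_of_real \<alpha>)) {0<..}"
      using that \<open>\<alpha> > 0\<close> by (simp add: has_integral_stretch_Ioi_iff scaleR_conv_of_real)
    from has_integral_mult_right[OF this, of k] show ?thesis
      \<comment> \<open>\<open>F_eq\<close> is available only for positive \<open>x\<close>, so the
        integrands are exchanged on the half-line rather than as functions.\<close>
      by (subst has_integral_cong[where g = "\<lambda>x. k * G (\<alpha> * x)"]) (simp_all add: F_eq)
  qed
  have G_of_F: "G integrable_on {0<..}" if "F integrable_on {0<..}"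
  proof -
    from that obtain I where "(F has_integral I) {0<..}"
      by blast
    from has_integral_mult_right[OF this, of "1 / k"]
    have "((\<lambda>x. G (\<alpha> * x)) has_integral (I / k)) {0<..}"
      by (subst has_integral_cong[where g = "\<lambda>x. 1 / k * F x"]) (simp_all add: F_eq k)
    then show ?thesis
      using \<open>\<alpha> > 0\<close> by (auto simp: has_integral_stretch_Ioi_iff)
  qed
  have iff: "F integrable_on {0<..} \<longleftrightarrow> G integrable_on {0<..}"
    using F_of_G G_of_F by blast
  have "integral {0<..} F = k / complex_of_real \<alpha> * integral {0<..} G"
  proof (cases "G integrable_on {0<..}")
    case True
    then show ?thesis
      by (intro integral_unique F_of_G integrable_integral)
  next
    \<comment> \<open>By \<open>iff\<close> neither integral exists, so both take the default value
      0 and the identity reads 0 = 0.\<close>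
    case False
    then show ?thesis
      by (simp add: iff not_integrable_integral)
  qed
  with iff show ?thesis
    unfolding M_converges_def M_transform_def factor F_def G_def by simp
qed

end
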